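(* Every triangle-free graph $G$ with maximum degree $\Delta(G)\ge 1$ satisfies $$\operatorname{diam}(G)\le \Delta(G)+\lfloor \log_2 \Delta(G)\rfloor .$$
   Context: Graphs are finite and simple. For an oriented graph $\overrightarrow{G}$ and $X\subseteq V(\overrightarrow{G})$, the inversion of $X$ reverses every arc having both endpoints in $X$ (and no other arc). For a (labeled) graph $G$, the inversion distance between two orientations of $G$ is the minimum number of inversions transforming one into the other (equality as labeled oriented graphs), and the inversion diameter $\operatorname{diam}(G)$ is the maximum inversion distance over all pairs of orientations of $G$. $\Delta(G)$ denotes the maximum degree of $G$. *)

theory Defs
  imports Complex_Main "Graph_Theory.Pair_Digraph"
begin

text \<open>
  A finite simple graph is a \<open>pair_graph\<close>: a finite loopless digraph with at most one arc from any
  vertex to any other, in which the arcs \<open>(u, v)\<close> and \<open>(v, u)\<close> occur together and stand for the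
  edge \<open>uv\<close>.
\<close>

definition triangle_free :: "'a pair_pre_digraph \<Rightarrow> bool" where
  "triangle_free G \<longleftrightarrow>
     \<not> (\<exists>u v w. (u, v) \<in> parcs G \<and> (v, w) \<in> parcs G \<and> (w, u) \<in> parcs G)"

text \<open>
  For a symmetric digraph the out-degree is the degree of the underlying graph. The inserted \<open>0\<close>
  only fixes the value for the graph without vertices.
\<close>

definition max_degree :: "'a pair_pre_digraph \<Rightarrow> nat" where
  "max_degree G = Max (insert 0 (out_degree (with_proj G) ` pverts G))"

definition orientation_of :: "'a pair_pre_digraph \<Rightarrow> 'a pair_pre_digraph \<Rightarrow> bool" where
  "orientation_of G D \<longleftrightarrow>
     pverts D = pverts G \<and> parcs D \<union> (parcs D)\<inverse> = parcs G \<and> parcs D \<inter> (parcs D)\<inverse> = {}"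

definition inversion :: "'a set \<Rightarrow> 'a pair_pre_digraph \<Rightarrow> 'a pair_pre_digraph" where
  "inversion X D = D\<lparr>parcs := (parcs D - X \<times> X) \<union> (parcs D \<inter> X \<times> X)\<inverse>\<rparr>"

definition transforms ::
  "'a set list \<Rightarrow> 'a pair_pre_digraph \<Rightarrow> 'a pair_pre_digraph \<Rightarrow> bool" where
  "transforms Xs D D' \<longleftrightarrow> (\<forall>X \<in> set Xs. X \<subseteq> pverts D) \<and> fold inversion Xs D = D'"

definition inversion_distance :: "'a pair_pre_digraph \<Rightarrow> 'a pair_pre_digraph \<Rightarrow> nat" where
  "inversion_distance D D' = (LEAST k. \<exists>Xs. length Xs = k \<and> transforms Xs D D')"

definition inversion_diameter :: "'a pair_pre_digraph \<Rightarrow> nat" where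
  "inversion_diameter G =
     Max {inversion_distance D D' | D D'. orientation_of G D \<and> orientation_of G D'}"

text \<open>
  The minimum and the maximum above are attained: any two orientations of a finite simple graph are
  connected by inversions, and the orientations form a finite nonempty set.
\<close>

lemma pverts_inversion [simp]: "pverts (inversion X D) = pverts D"
  by (simp add: inversion_def)

lemma orientation_of_arc:
  assumes "orientation_of G D" "orientation_of G D'" "(u, v) \<in> parcs D"
  shows "(v, u) \<notin> parcs D" and "(u, v) \<in> parcs D' \<or> (v, u) \<in> parcs D'"
proof -
  show "(v, u) \<notin> parcs D"
    using assms(1,3) by (auto simp: orientation_of_def)
  have "(u, v) \<in> parcs G"
    using assms(1,3) by (auto simp: orientation_of_def)
  then have "(u, v) \<in> parcs D' \<union> (parcs D')\<inverse>"
    using assms(2) by (simp add: orientation_of_def)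
  then show "(u, v) \<in> parcs D' \<or> (v, u) \<in> parcs D'" by simp
qed

lemma orientation_of_inversion:
  assumes "orientation_of G D"
  shows "orientation_of G (inversion X D)"
proof -
  have "parcs (inversion X D) \<union> (parcs (inversion X D))\<inverse> = parcs D \<union> (parcs D)\<inverse>"
    by (auto simp: inversion_def)
  moreover have "parcs (inversion X D) \<inter> (parcs (inversion X D))\<inverse> = {}"
    using assms by (auto simp: inversion_def orientation_of_def)
  ultimately show ?thesis
    using assms by (simp add: orientation_of_def)
qed

lemma orientation_transforms_ex:
  assumes "pair_graph G" "orientation_of G D" "orientation_of G D'"
  shows "\<exists>Xs. transforms Xs D D'"
  using assms(2)
proof (induction "card (parcs D - parcs D')" arbitrary: D rule: less_induct)
  case less
  interpret pair_graph G by fact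
  note o = less.prems assms(3)
  have fin: "finite (parcs D)"
    using o(1) pair_finite_arcs by (metis finite_Un orientation_of_def)
  show ?case
  proof (cases "parcs D \<subseteq> parcs D'")
    case True
    have "parcs D' \<subseteq> parcs D"
    proof
      fix e assume e: "e \<in> parcs D'"
      obtain u v where uv: "e = (u, v)" by (cases e)
      have "(u, v) \<in> parcs D \<or> (v, u) \<in> parcs D" "(v, u) \<notin> parcs D'"
        using orientation_of_arc[OF o(2,1)] e uv by auto
      then show "e \<in> parcs D" using True uv by blast
    qed
    with True o have "D = D'"
      by (simp add: orientation_of_def)
    then have "transforms [] D D'" by (simp add: transforms_def)
    then show ?thesis ..
  next
    case False
    then obtain u v where uv: "(u, v) \<in> parcs D" "(u, v) \<notin> parcs D'" by auto
    have vu: "(v, u) \<in> parcs D'" "(v, u) \<notin> parcs D"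
      using orientation_of_arc[OF o uv(1)] uv by auto
    have "(w, w) \<notin> parcs D" for w
      using orientation_of_arc(1)[OF o(1,1)] by blast
    then have "parcs (inversion {u, v} D) - parcs D' = parcs D - parcs D' - {(u, v)}"
      using uv vu by (auto simp: inversion_def)
    then have "card (parcs (inversion {u, v} D) - parcs D') < card (parcs D - parcs D')"
      using uv fin by (metis Diff_iff card_Diff1_less finite_Diff)
    from less.hyps[OF this orientation_of_inversion[OF o(1)]]
    obtain Xs where "transforms Xs (inversion {u, v} D) D'" by blast
    moreover have "{u, v} \<subseteq> pverts D"
    proof -
      have "(u, v) \<in> parcs G" "pverts D = pverts G"
        using uv o(1) by (auto simp: orientation_of_def)
      then show ?thesis using in_arcsD1 in_arcsD2 by simp
    qed
    ultimately have "transforms ({u, v} # Xs) D D'" by (simp add: transforms_def)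
    then show ?thesis ..
  qed
qed

lemma inversion_distance_attained:
  assumes "pair_graph G" "orientation_of G D" "orientation_of G D'"
  shows "\<exists>Xs. length Xs = inversion_distance D D' \<and> transforms Xs D D'"
  unfolding inversion_distance_def
  by (rule LeastI_ex) (use orientation_transforms_ex[OF assms] in blast)

lemma inversion_distance_le:
  assumes "transforms Xs D D'"
  shows "inversion_distance D D' \<le> length Xs"
  unfolding inversion_distance_def by (rule Least_le) (use assms in blast)

lemma finite_orientations:
  assumes "pair_graph G"
  shows "finite {D. orientation_of G D}"
proof (rule finite_subset)
  interpret pair_graph G by fact
  show "{D. orientation_of G D} \<subseteq> (\<lambda>A. \<lparr>pverts = pverts G, parcs = A\<rparr>) ` Pow (parcs G)"
  proof
    fix D assume "D \<in> {D. orientation_of G D}"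
    then have "D = \<lparr>pverts = pverts G, parcs = parcs D\<rparr>" "parcs D \<in> Pow (parcs G)"
      by (auto simp: orientation_of_def)
    then show "D \<in> (\<lambda>A. \<lparr>pverts = pverts G, parcs = A\<rparr>) ` Pow (parcs G)" by blast
  qed
  show "finite ((\<lambda>A. \<lparr>pverts = pverts G, parcs = A\<rparr>) ` Pow (parcs G))"
    using pair_finite_arcs by simp
qed

lemma orientation_ex:
  assumes "pair_graph G"
  shows "\<exists>D. orientation_of G D"
proof -
  interpret pair_graph G by fact
  obtain f :: "'a \<Rightarrow> nat" where f: "inj_on f (pverts G)"
    using finite_imp_inj_to_nat_seg[OF pair_finite_verts] by blast
  define D where "D = \<lparr>pverts = pverts G, parcs = {(u, v) \<in> parcs G. f u < f v}\<rparr>"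
  have neq: "f u \<noteq> f v" if "(u, v) \<in> parcs G" for u v
    using that f in_arcsD1 in_arcsD2 pair_no_loops[OF that] by (auto dest: inj_onD)
  have "orientation_of G D"
    using arcs_symmetric neq by (fastforce simp: orientation_of_def D_def nat_neq_iff)
  then show ?thesis ..
qed

lemma finite_inversion_distances:
  assumes "pair_graph G"
  shows "finite {inversion_distance D D' | D D'. orientation_of G D \<and> orientation_of G D'}"
  by (rule finite_image_set2[OF finite_orientations[OF assms] finite_orientations[OF assms]])

lemma inversion_distances_nonempty:
  assumes "pair_graph G"
  shows "{inversion_distance D D' | D D'. orientation_of G D \<and> orientation_of G D'} \<noteq> {}"
  using orientation_ex[OF assms] by blast

end

theory Submission
  imports Defs
begin

text \<open>
  Vectors over the two-element field are represented by subsets of a finite set \<open>S\<close>: the sum is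
  the symmetric difference and the scalar product is the parity of the intersection. If the vertices
  carry vectors, inverting for each coordinate \<open>i\<close> the set of vertices whose vector contains \<open>i\<close>
  reverses exactly the edges whose end vectors have scalar product \<open>1\<close>. So it suffices to find, for
  every prescription of scalar products on the edges, such vectors of dimension
  \<open>\<Delta> + \<lfloor>log\<^sub>2 \<Delta>\<rfloor>\<close>.

  They are found by adding one vertex \<open>v\<close> at a time. Choose the vector of \<open>v\<close> outside the span of
  the vectors of the other neighbours of \<open>x\<close>, for every neighbour \<open>x\<close> of \<open>v\<close>; this excludes at
  most \<open>\<Delta> * 2 ^ (\<Delta> - 1)\<close> vectors, fewer than there are. The linear system for the vector of each
  such \<open>x\<close> was solvable and remains so with the equation for \<open>v\<close> added. Re-solving it for all \<open>x\<close>
  at once causes no conflict, since by triangle-freeness no two neighbours of \<open>v\<close> are adjacent.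
\<close>

section \<open>Linear algebra over the two-element field\<close>

lemma odd_card_sym_diff_Int:
  assumes "finite A" "finite B"
  shows "odd (card (sym_diff A B \<inter> C)) \<longleftrightarrow> odd (card (A \<inter> C)) \<noteq> odd (card (B \<inter> C))"
proof -
  \<comment> \<open>The common part \<open>?I\<close> lies in both \<open>A \<inter> C\<close> and
    \<open>B \<inter> C\<close>, so it cancels modulo 2.\<close>
  let ?A = "(A - B) \<inter> C" and ?B = "(B - A) \<inter> C" and ?I = "A \<inter> B \<inter> C"
  have "sym_diff A B \<inter> C = ?A \<union> ?B" "A \<inter> C = ?A \<union> ?I" "B \<inter> C = ?B \<union> ?I"
    by auto
  moreover have "card (?A \<union> ?B) = card ?A + card ?B" "card (?A \<union> ?I) = card ?A + card ?I"
    "card (?B \<union> ?I) = card ?B + card ?I"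
    using assms by (auto intro!: card_Un_disjoint)
  ultimately show ?thesis
    by (simp only:) auto
qed

text \<open>
  The double orthogonal complement is the span; defining the span in this way makes the solvability
  of linear systems immediate, and only the bound on its size needs an argument.
\<close>

definition span2 :: "'b set \<Rightarrow> 'b set set \<Rightarrow> 'b set set" where
  "span2 S A = {c \<in> Pow S.
     \<forall>y \<in> Pow S. (\<forall>a \<in> A. even (card (a \<inter> y))) \<longrightarrow> even (card (c \<inter> y))}"

text \<open>A vector containing \<open>i\<close> has product 1 with the unit vector
  \<open>{i}\<close>, so only zero is orthogonal to the whole space.\<close>

lemma span2_empty:
  assumes "finite S"
  shows "span2 S {} = {{}}"
proof -
  have "c = {}" if "c \<in> span2 S {}" for c
  proof (rule ccontr)
    assume "c \<noteq> {}"
    then obtain i where i: "i \<in> c" by blast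
    then have "{i} \<in> Pow S"
      using that by (auto simp: span2_def)
    then have "even (card (c \<inter> {i}))"
      using that by (simp add: span2_def)
    then show False
      using i by simp
  qed
  then show ?thesis
    by (auto simp: span2_def)
qed

text \<open>Let \<open>c\<close> lie outside the old span, witnessed by \<open>y\<close> orthogonal
  to \<open>A\<close> but not to \<open>c\<close>; then \<open>y\<close> is not orthogonal to
  \<open>a\<close> either. If \<open>z\<close> is orthogonal to \<open>A\<close> but not to
  \<open>a\<close>, the sum of \<open>y\<close> and \<open>z\<close> is orthogonal to
  \<open>a\<close>, hence to \<open>c\<close>. So \<open>a\<close> and \<open>c\<close> have equal
  products with every \<open>z\<close> orthogonal to \<open>A\<close>, which puts their sum in the
  old span.\<close>

lemma span2_insert_subset:
  assumes "finite S" "a \<subseteq> S"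
  shows "span2 S (insert a A) \<subseteq> span2 S A \<union> sym_diff a ` span2 S A"
proof
  fix c assume c: "c \<in> span2 S (insert a A)"
  have cS: "c \<subseteq> S"
    using c by (simp add: span2_def)
  have fin: "finite x" if "x \<subseteq> S" for x
    using that assms(1) by (rule finite_subset)
  show "c \<in> span2 S A \<union> sym_diff a ` span2 S A"
  proof (cases "c \<in> span2 S A")
    case False
    then obtain y where y: "y \<subseteq> S" "\<forall>b \<in> A. even (card (b \<inter> y))" "odd (card (c \<inter> y))"
      using cS by (auto simp: span2_def)
    have ay: "odd (card (a \<inter> y))"
      using c y by (auto simp: span2_def)
    have "even (card (sym_diff a c \<inter> z))"
      if z: "z \<subseteq> S" "\<forall>b \<in> A. even (card (b \<inter> z))" for z
    proof -
      have sum: "odd (card (x \<inter> sym_diff y z)) \<longleftrightarrow> odd (card (x \<inter> y)) \<noteq> odd (card (x \<inter> z))"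
        for x
        using odd_card_sym_diff_Int[OF fin fin, of y z x] y z by (simp add: Int_commute)
      have "odd (card (a \<inter> z)) \<longleftrightarrow> odd (card (c \<inter> z))"
      proof (cases "odd (card (a \<inter> z))")
        case True
        have "\<forall>b \<in> insert a A. even (card (b \<inter> sym_diff y z))"
          using sum y z ay True by blast
        moreover have "sym_diff y z \<in> Pow S"
          using y z by blast
        ultimately have "even (card (c \<inter> sym_diff y z))"
          using c unfolding span2_def by blast
        then show ?thesis
          using sum y True by blast
      next
        case False
        then show ?thesis
          using c z by (auto simp: span2_def)
      qed
      then show ?thesis
        using odd_card_sym_diff_Int[OF fin fin, of a c z] assms cS by blast
    qed
    then have "sym_diff a c \<in> span2 S A"
      using assms cS by (auto simp: span2_def)
    moreover have "c = sym_diff a (sym_diff a c)"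
      by blast
    ultimately show ?thesis
      by blast
  qed simp
qed

text \<open>By the preceding lemma, each new generator at most doubles the span.\<close>

lemma card_span2_le:
  assumes "finite S" "finite A" "A \<subseteq> Pow S"
  shows "card (span2 S A) \<le> 2 ^ card A"
  using assms(2,3)
proof (induction A rule: finite_induct)
  case empty
  then show ?case
    using assms(1) by (simp add: span2_empty)
next
  case (insert a A)
  have fin: "finite (span2 S A)"
    using assms(1) by (simp add: span2_def)
  have "card (span2 S (insert a A)) \<le> card (span2 S A \<union> sym_diff a ` span2 S A)"
    using insert.prems assms(1) fin by (intro card_mono span2_insert_subset) auto
  also have "\<dots> \<le> card (span2 S A) + card (sym_diff a ` span2 S A)"
    by (rule card_Un_le)
  also have "\<dots> \<le> card (span2 S A) + card (span2 S A)"
    using card_image_le[OF fin] by simp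
  also have "\<dots> \<le> 2 ^ card (insert a A)"
    using insert by simp
  finally show ?case .
qed

lemma ex_vectors_with_prescribed_products:
  fixes E :: "'a rel" and S :: "'b set" and p :: "'a \<Rightarrow> 'a \<Rightarrow> bool"
  assumes E: "sym E" "irrefl E"
    and triangle: "\<And>u v w. (u, v) \<in> E \<Longrightarrow> (v, w) \<in> E \<Longrightarrow> (w, u) \<notin> E"
    and degree: "\<And>v. finite (E `` {v})" "\<And>v. card (E `` {v}) \<le> d"
    and S: "finite S" "d * 2 ^ (d - 1) < 2 ^ card S"
    and p: "\<And>u v. (u, v) \<in> E \<Longrightarrow> p u v = p v u"
    and W: "finite W"
  shows "\<exists>f. (\<forall>v. f v \<subseteq> S) \<and>
    (\<forall>u \<in> W. \<forall>v \<in> W. (u, v) \<in> E \<longrightarrow> odd (card (f u \<inter> f v)) = p u v)"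
  using W
proof (induction W rule: finite_induct)
  case empty
  show ?case by (intro exI[of _ "\<lambda>_. {}"]) simp
next
  case (insert v W)
  then obtain f where fS: "\<And>v. f v \<subseteq> S"
    and f: "\<And>u v. u \<in> W \<Longrightarrow> v \<in> W \<Longrightarrow> (u, v) \<in> E \<Longrightarrow> odd (card (f u \<inter> f v)) = p u v"
    by blast
  define N where "N = E `` {v} \<inter> W"
  define M where "M x = E `` {x} \<inter> W" for x
  have N: "finite N" "card N \<le> d"
    unfolding N_def using degree[of v] card_mono[OF degree(1), of "E `` {v} \<inter> W" v] by auto
  have span: "card (span2 S (f ` M x)) \<le> 2 ^ (d - 1)" if "x \<in> N" for x
  proof -
    \<comment> \<open>The new vertex \<open>v\<close> is itself a neighbour of \<open>x\<close>
      outside \<open>W\<close>, which lowers \<open>d\<close> to \<open>d - 1\<close>.\<close>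
    have "v \<in> E `` {x}" "M x \<subseteq> E `` {x} - {v}"
      using that E(1) insert.hyps by (auto simp: N_def M_def dest: symD)
    then have "card (M x) \<le> d - 1"
      using degree[of x] card_mono[of "E `` {x} - {v}" "M x"] by fastforce
    moreover have fin: "finite (M x)"
      using insert.hyps by (simp add: M_def)
    ultimately have "card (f ` M x) \<le> d - 1"
      using card_image_le le_trans by blast
    moreover have "card (span2 S (f ` M x)) \<le> 2 ^ card (f ` M x)"
      using S fS fin by (intro card_span2_le) auto
    ultimately show ?thesis
      using le_trans power_increasing one_le_numeral by blast
  qed
  have "card (\<Union>x\<in>N. span2 S (f ` M x)) \<le> (\<Sum>x\<in>N. card (span2 S (f ` M x)))"
    by (rule card_UN_le[OF N(1)])
  also have "\<dots> \<le> card N * 2 ^ (d - 1)"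
    using sum_bounded_above[OF span] by simp
  also have "\<dots> \<le> d * 2 ^ (d - 1)"
    using N(2) by simp
  also have "\<dots> < card (Pow S)"
    using S by (simp add: card_Pow)
  finally have "\<not> Pow S \<subseteq> (\<Union>x\<in>N. span2 S (f ` M x))"
    using N(1) S(1) by (auto simp: span2_def not_le dest!: card_mono[rotated])
  then obtain c where c: "c \<subseteq> S" "\<And>x. x \<in> N \<Longrightarrow> c \<notin> span2 S (f ` M x)"
    by blast
  have "\<exists>g \<subseteq> S. odd (card (g \<inter> c)) = p x v \<and> (\<forall>w \<in> M x. odd (card (g \<inter> f w)) = p x w)"
    if x: "x \<in> N" for x
  proof -
    have old: "\<forall>w \<in> M x. odd (card (f x \<inter> f w)) = p x w"
      using f x by (simp add: M_def N_def)
    \<comment> \<open>As \<open>c\<close> avoids the span, some \<open>y\<close> is orthogonal to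
      all vectors on \<open>M x\<close> but not to \<open>c\<close>. Adding it to \<open>f x\<close>
      flips the product with \<open>c\<close> and keeps the others.\<close>
    obtain y where y: "y \<subseteq> S" "\<forall>w \<in> M x. even (card (f w \<inter> y))" "odd (card (c \<inter> y))"
      using c(1) c(2)[OF x] by (auto simp: span2_def)
    have fin: "finite (f x)" "finite y"
      using fS y(1) S(1) finite_subset by blast+
    show ?thesis
    proof (cases "odd (card (f x \<inter> c)) = p x v")
      case True
      then show ?thesis
        using old fS by blast
    next
      case False
      have "odd (card (sym_diff (f x) y \<inter> c)) = p x v"
        using odd_card_sym_diff_Int[OF fin, of c] False y by (simp add: Int_commute)
      moreover have "\<forall>w \<in> M x. odd (card (sym_diff (f x) y \<inter> f w)) = p x w"
        using odd_card_sym_diff_Int[OF fin] old y by (simp add: Int_commute)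
      moreover have "sym_diff (f x) y \<subseteq> S"
        using fS y by blast
      ultimately show ?thesis
        by blast
    qed
  qed
  then obtain g where gS: "\<And>x. x \<in> N \<Longrightarrow> g x \<subseteq> S"
    and gv: "\<And>x. x \<in> N \<Longrightarrow> odd (card (g x \<inter> c)) = p x v"
    and gM: "\<And>x w. x \<in> N \<Longrightarrow> w \<in> M x \<Longrightarrow> odd (card (g x \<inter> f w)) = p x w"
    by metis
  define h where "h = (\<lambda>u. if u = v then c else if u \<in> N then g u else f u)"
  \<comment> \<open>Up to swapping the ends, \<open>w \<in> W\<close> and \<open>cond\<close> cover
    every edge inside \<open>insert v W\<close>: what they exclude is \<open>w = v\<close>, and
    \<open>w \<in> N\<close> with \<open>u\<close> an old vertex outside \<open>N\<close>.\<close>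
  have half: "odd (card (h u \<inter> h w)) = p u w"
    if uw: "u \<in> insert v W" "w \<in> W" "(u, w) \<in> E" and cond: "u = v \<or> u \<in> N \<or> w \<notin> N" for u w
  proof -
    have wv: "w \<noteq> v"
      using uw insert.hyps by auto
    consider "u = v" | "u \<noteq> v" "u \<in> N" | "u \<noteq> v" "u \<notin> N" "w \<notin> N"
      using cond by blast
    then show ?thesis
    proof cases
      case 1
      then have "w \<in> N"
        using uw by (simp add: N_def)
      then show ?thesis
        using 1 gv[of w] wv p[OF uw(3)] by (simp add: h_def Int_commute)
    next
      case 2
      \<comment> \<open>Otherwise \<open>v\<close>, \<open>u\<close> and \<open>w\<close> would form
        a triangle. Hence \<open>w\<close> keeps the vector \<open>f w\<close>, for which
        \<open>g u\<close> was built.\<close>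
      then have "w \<notin> N"
        using triangle[of v u w] uw E(1) by (auto simp: N_def dest: symD)
      then show ?thesis
        using 2 gM[of u w] wv uw by (simp add: h_def M_def)
    next
      case 3
      then show ?thesis
        using f[of u w] wv uw by (simp add: h_def)
    qed
  qed
  have "odd (card (h u \<inter> h w)) = p u w"
    if uw: "u \<in> insert v W" "w \<in> insert v W" "(u, w) \<in> E" for u w
  proof (cases "w \<in> W \<and> (u = v \<or> u \<in> N \<or> w \<notin> N)")
    case True
    then show ?thesis
      using half uw by blast
  next
    case False
    have "u \<noteq> w" "(w, u) \<in> E"
      using uw E by (auto simp: irrefl_def dest: symD)
    then have "odd (card (h w \<inter> h u)) = p w u"
      using False uw by (intro half) auto
    then show ?thesis
      using p[OF uw(3)] by (simp add: Int_commute)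
  qed
  moreover have "h u \<subseteq> S" for u
    using c gS fS by (simp add: h_def)
  ultimately show ?case
    by (intro exI[of _ h]) simp
qed

section \<open>From vectors to inversions\<close>

lemma pverts_fold_inversion [simp]: "pverts (fold inversion Xs D) = pverts D"
  by (induction Xs arbitrary: D) auto

lemma parcs_inversion_iff:
  "(u, v) \<in> parcs (inversion X D) \<longleftrightarrow>
     (if u \<in> X \<and> v \<in> X then (v, u) \<in> parcs D else (u, v) \<in> parcs D)"
  by (auto simp: inversion_def)

lemma parcs_fold_inversion_iff:
  "(u, v) \<in> parcs (fold inversion Xs D) \<longleftrightarrow>
     (if odd (length (filter (\<lambda>X. u \<in> X \<and> v \<in> X) Xs)) then (v, u) \<in> parcs D
      else (u, v) \<in> parcs D)"
  by (induction Xs arbitrary: D) (auto simp: parcs_inversion_iff)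

lemma inversion_distance_le_dimension:
  fixes f :: "'a \<Rightarrow> nat set"
  assumes D: "orientation_of G D" "orientation_of G D'"
    and f: "\<And>v. f v \<subseteq> {..<t}"
    and arcs: "\<And>u v. (u, v) \<in> parcs G \<Longrightarrow> u \<in> pverts G \<and> v \<in> pverts G"
    and prod: "\<And>u v. (u, v) \<in> parcs G \<Longrightarrow>
      odd (card (f u \<inter> f v)) \<longleftrightarrow> ((u, v) \<in> parcs D) \<noteq> ((u, v) \<in> parcs D')"
  shows "inversion_distance D D' \<le> t"
proof -
  \<comment> \<open>One set per coordinate, restricted to \<open>pverts G\<close> because
    \<open>transforms\<close> admits only sets of vertices.\<close>
  define Xs where "Xs = map (\<lambda>i. {v \<in> pverts G. i \<in> f v}) [0..<t]"
  have verts: "pverts D = pverts G" "pverts D' = pverts G"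
    using D by (simp_all add: orientation_of_def)
  have "(u, v) \<in> parcs (fold inversion Xs D) \<longleftrightarrow> (u, v) \<in> parcs D'" for u v
  proof (cases "(u, v) \<in> parcs G")
    case True
    have "length (filter (\<lambda>X. u \<in> X \<and> v \<in> X) Xs) =
      card ({i. i \<in> f u \<and> i \<in> f v} \<inter> set [0..<t])"
      using arcs[OF True] by (simp add: Xs_def filter_map o_def distinct_length_filter)
    also have "{i. i \<in> f u \<and> i \<in> f v} \<inter> set [0..<t] = f u \<inter> f v"
      using f[of u] by auto
    finally have "odd (length (filter (\<lambda>X. u \<in> X \<and> v \<in> X) Xs)) \<longleftrightarrow>
      ((u, v) \<in> parcs D) \<noteq> ((u, v) \<in> parcs D')"
      using prod[OF True] by simp
    \<comment> \<open>Exactly one direction of an edge lies in \<open>D\<close>, so an odd number of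
      reversals negates membership.\<close>
    moreover have "(u, v) \<in> parcs D \<longleftrightarrow> (v, u) \<notin> parcs D"
      using D(1) True by (auto simp: orientation_of_def)
    ultimately show ?thesis
      by (auto simp: parcs_fold_inversion_iff)
  next
    case False
    then have "(u, v) \<notin> parcs D" "(v, u) \<notin> parcs D" "(u, v) \<notin> parcs D'"
      using D by (auto simp: orientation_of_def)
    then show ?thesis
      by (simp add: parcs_fold_inversion_iff)
  qed
  then have "fold inversion Xs D = D'"
    using verts by (intro pair_pre_digraph.equality) auto
  then have "transforms Xs D D'"
    using verts by (auto simp: transforms_def Xs_def)
  then show ?thesis
    using inversion_distance_le[of Xs D D'] by (simp add: Xs_def)
qed

section \<open>Degrees and the dimension count\<close>

lemma (in pair_fin_digraph) card_neighbours_le_max_degree: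
  "card (parcs G `` {v}) \<le> max_degree G"
proof (cases "v \<in> pverts G")
  case True
  have "out_arcs (with_proj G) v = Pair v ` (parcs G `` {v})"
    by (auto simp: out_arcs_def)
  then have "card (parcs G `` {v}) = out_degree (with_proj G) v"
    by (simp add: out_degree_def card_image inj_on_def)
  then show ?thesis
    using True pair_finite_verts by (simp add: max_degree_def)
next
  case False
  then have "parcs G `` {v} = {}"
    using in_arcsD1 by auto
  then show ?thesis
    by simp
qed

lemma mult_power_less_power_add_floor_log:
  assumes "d \<ge> 1"
  shows "d * 2 ^ (d - 1) < (2 ^ (d + nat \<lfloor>log 2 (real d)\<rfloor>) :: nat)"
proof -
  define k where "k = nat \<lfloor>log 2 (real d)\<rfloor>"
  \<comment> \<open>The floor gives only \<open>d < 2 ^ (k + 1)\<close>; the surplus factor 2 is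
    absorbed by the exponent \<open>d - 1\<close>.\<close>
  have "log 2 (real d) < real (k + 1)"
    unfolding k_def by linarith
  then have "real d < 2 powr real (k + 1)"
    using assms by (simp add: log_less_iff)
  then have "d < 2 ^ (k + 1)"
    by (metis numeral_less_real_of_nat_iff of_nat_less_iff of_nat_numeral of_nat_power
        powr_realpow zero_less_numeral)
  then have "d * 2 ^ (d - 1) < 2 ^ (k + 1) * 2 ^ (d - 1)"
    by simp
  also have "\<dots> = 2 ^ (k + 1 + (d - 1))"
    by (rule power_add[symmetric])
  also have "k + 1 + (d - 1) = d + k"
    using assms by simp
  finally show ?thesis
    by (simp add: k_def)
qed

theorem theorem1p4:
  fixes G :: "'a pair_pre_digraph"
  assumes "pair_graph G"
    and "triangle_free G"
    and "max_degree G \<ge> 1"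
  shows "int (inversion_diameter G) \<le> int (max_degree G) + \<lfloor>log 2 (real (max_degree G))\<rfloor>"
proof -
  interpret pair_graph G by fact
  define t where "t = max_degree G + nat \<lfloor>log 2 (real (max_degree G))\<rfloor>"
  have "inversion_distance D D' \<le> t" if D: "orientation_of G D" "orientation_of G D'" for D D'
  proof -
    \<comment> \<open>These are the edges on which the orientations disagree, so exactly those to be
      reversed.\<close>
    define p where "p u v \<longleftrightarrow> ((u, v) \<in> parcs D) \<noteq> ((u, v) \<in> parcs D')" for u v
    have "\<exists>f :: 'a \<Rightarrow> nat set. (\<forall>v. f v \<subseteq> {..<t}) \<and>
      (\<forall>u \<in> pverts G. \<forall>v \<in> pverts G. (u, v) \<in> parcs G \<longrightarrow> odd (card (f u \<inter> f v)) = p u v)"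
    proof (rule ex_vectors_with_prescribed_products)
      show "sym (parcs G)"
        using arcs_symmetric by (auto intro: symI)
      show "irrefl (parcs G)"
      proof (rule irreflI)
        show "(v, v) \<notin> parcs G" for v
          using pair_no_loops[of "(v, v)"] by auto
      qed
      show "(w, u) \<notin> parcs G" if "(u, v) \<in> parcs G" "(v, w) \<in> parcs G" for u v w
        using assms(2) that unfolding triangle_free_def by blast
      show "finite (parcs G `` {v})" for v
        using pair_finite_arcs by (rule finite_Image)
      show "card (parcs G `` {v}) \<le> max_degree G" for v
        by (rule card_neighbours_le_max_degree)
      show "max_degree G * 2 ^ (max_degree G - 1) < 2 ^ card {..<t}"
        using mult_power_less_power_add_floor_log[OF assms(3)] unfolding t_def card_lessThan .
      show "p u v = p v u" if "(u, v) \<in> parcs G" for u v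
      proof -
        \<comment> \<open>Swapping the ends negates membership in both orientations, which preserves
          disagreement.\<close>
        have "(u, v) \<in> parcs C \<longleftrightarrow> (v, u) \<notin> parcs C" if "orientation_of G C" for C
          using that \<open>(u, v) \<in> parcs G\<close> unfolding orientation_of_def by blast
        from this[OF D(1)] this[OF D(2)] show ?thesis
          unfolding p_def by blast
      qed
    qed (use pair_finite_verts in auto)
    then obtain f :: "'a \<Rightarrow> nat set" where f: "\<And>v. f v \<subseteq> {..<t}"
      "\<And>u v. u \<in> pverts G \<Longrightarrow> v \<in> pverts G \<Longrightarrow> (u, v) \<in> parcs G \<Longrightarrow>
        odd (card (f u \<inter> f v)) = p u v"
      by blast
    show ?thesis
    proof (rule inversion_distance_le_dimension[OF D f(1)])
      show verts: "u \<in> pverts G \<and> v \<in> pverts G" if "(u, v) \<in> parcs G" for u v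
        using in_arcsD1[OF that] in_arcsD2[OF that] by blast
      show "odd (card (f u \<inter> f v)) \<longleftrightarrow> ((u, v) \<in> parcs D) \<noteq> ((u, v) \<in> parcs D')"
        if "(u, v) \<in> parcs G" for u v
        using f(2)[OF _ _ that] verts[OF that] unfolding p_def by blast
    qed
  qed
  then have "inversion_diameter G \<le> t"
    unfolding inversion_diameter_def
    using finite_inversion_distances[OF assms(1)] inversion_distances_nonempty[OF assms(1)]
    by (subst Max_le_iff) auto
  \<comment> \<open>The maximum degree is positive, so the \<open>nat\<close> in \<open>t\<close>
    leaves the bound unchanged.\<close>
  moreover have "\<lfloor>log 2 (real (max_degree G))\<rfloor> \<ge> 0"
    using assms(3) by simp
  ultimately show ?thesis
    unfolding t_def by linarith
qed

end
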